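(* Let $\mathcal{A}=\mathbb{C}[t^{\pm1}]$ and let $\sigma\neq\mathrm{id}$ be the algebra endomorphism of $\mathcal{A}$ with $\sigma(t)=qt^s$, where $q\in\mathbb{C}^*$, $s\in\mathbb{Z}$. Let $d=|s-1|$. For all integers $0\leq n<m<d$ one has: 1. If $n+m<d$ then $[d_n,d_m]_\sigma\equiv(n-m)d_{m+n}$. In particular, for $n=0$ one gets $[d_0,d_m]_\sigma=-m\,d_m+\widetilde\Delta$ with $\widetilde\Delta\in\mathcal{I}nn_\sigma(\mathcal{A})$, and for $n=0$, $m=1$ one has exactly $[d_0,d_1]_\sigma=-d_1$. 2. If $n+m\geq d$ then (a) $[d_n,d_m]_\sigma\equiv\dfrac{n-m}{q}\,d_{m+n-d}$ if $s\geq1$; (b) $[d_n,d_m]_\sigma\equiv q(n-m)\,d_{m+n-d}$ if $s<1$.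
   Context: A $\sigma$-derivation of $\mathcal{A}$ is a $\mathbb{C}$-linear map $D:\mathcal{A}\to\mathcal{A}$ with $D(ab)=\sigma(a)D(b)+D(a)b$ for all $a,b\in\mathcal{A}$; $\mathcal{D}_\sigma(\mathcal{A})$ is the set of all of them, a left $\mathcal{A}$-module via $(aD)(r)=aD(r)$. A $\sigma$-derivation is inner if it equals $r\mapsto p(r-\sigma(r))$ for some $p\in\mathcal{A}$; $\mathcal{I}nn_\sigma(\mathcal{A})$ is the set of inner ones. For $x,y\in\mathcal{D}_\sigma(\mathcal{A})$, $x\equiv y$ means $x-y\in\mathcal{I}nn_\sigma(\mathcal{A})$. Put $g=1-qt^{s-1}$ if $s\geq1$ and $g=1-q^{-1}t^{1-s}$ if $s<1$; this $g$ is a greatest common divisor of $(\mathrm{id}-\sigma)(\mathcal{A})$. Let $\Delta=(\mathrm{id}-\sigma)/g$; then $\mathcal{D}_\sigma(\mathcal{A})=\mathcal{A}\Delta$ is free of rank one over $\mathcal{A}$. For $n\in\mathbb{Z}$ let $d_n=-t^n\Delta$. The bracket is the $\mathbb{C}$-bilinear product on $\mathcal{D}_\sigma(\mathcal{A})$ given by $$[a\Delta,b\Delta]_\sigma=(\sigma(a)\Delta)\circ(b\Delta)-(\sigma(b)\Delta)\circ(a\Delta)=\big(\sigma(a)\Delta(b)-\sigma(b)\Delta(a)\big)\Delta,\quad a,b\in\mathcal{A}.$$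
   Formalization: For s<1 the printed claims are false with the stated g (s=-1: [d_0,d_1]=q d_{-1}, not -d_1). Proved instead for s<1: the congruences with opposite signs and [d_0,d_1]=q d_s for the stated g, and the printed formulas for g=1-qt^{s-1}. The case s≥1 is as printed. *)

theory Defs
  imports Complex_Main "HOL-Library.Poly_Mapping"
begin

text \<open>
  Laurent polynomials over the complex numbers are the finitely supported maps from the
  integers to the complex numbers; the library multiplication on this type is convolution.
\<close>

type_synonym laurent = "int \<Rightarrow>\<^sub>0 complex"

definition const :: "complex \<Rightarrow> laurent" where
  "const c = Poly_Mapping.single 0 c"

definition tpow :: "int \<Rightarrow> laurent" where
  "tpow n = Poly_Mapping.single n 1"

definition cscale :: "complex \<Rightarrow> laurent \<Rightarrow> laurent" where
  "cscale c a = const c * a"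

lemma vector_space_cscale: "vector_space cscale"
  by unfold_locales
    (simp_all add: cscale_def const_def algebra_simps single_add mult_single
      flip: mult.assoc)

definition algebra_endomorphism :: "(laurent \<Rightarrow> laurent) \<Rightarrow> bool" where
  "algebra_endomorphism \<sigma> \<longleftrightarrow>
     Vector_Spaces.linear cscale cscale \<sigma> \<and> \<sigma> 1 = 1 \<and> (\<forall>a b. \<sigma> (a * b) = \<sigma> a * \<sigma> b)"

definition sigma_derivations :: "(laurent \<Rightarrow> laurent) \<Rightarrow> (laurent \<Rightarrow> laurent) set" where
  "sigma_derivations \<sigma> =
     {D. Vector_Spaces.linear cscale cscale D \<and> (\<forall>a b. D (a * b) = \<sigma> a * D b + D a * b)}"

definition inner_derivations :: "(laurent \<Rightarrow> laurent) \<Rightarrow> (laurent \<Rightarrow> laurent) set" where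
  "inner_derivations \<sigma> =
     {D \<in> sigma_derivations \<sigma>. \<exists>p. \<forall>r. D r = p * (r - \<sigma> r)}"

definition inner_equiv ::
    "(laurent \<Rightarrow> laurent) \<Rightarrow> (laurent \<Rightarrow> laurent) \<Rightarrow> (laurent \<Rightarrow> laurent) \<Rightarrow> bool" where
  "inner_equiv \<sigma> x y \<longleftrightarrow>
     x \<in> sigma_derivations \<sigma> \<and> y \<in> sigma_derivations \<sigma> \<and>
     (\<lambda>r. x r - y r) \<in> inner_derivations \<sigma>"

definition lact :: "laurent \<Rightarrow> (laurent \<Rightarrow> laurent) \<Rightarrow> laurent \<Rightarrow> laurent" where
  "lact a D = (\<lambda>r. a * D r)"

definition gelt :: "complex \<Rightarrow> int \<Rightarrow> laurent" where
  "gelt q s = (if s \<ge> 1 then 1 - cscale q (tpow (s - 1))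
               else 1 - cscale (inverse q) (tpow (1 - s)))"

text \<open>
  The following element agrees with the previous one for \<open>s \<ge> 1\<close>. For \<open>s < 1\<close> it is the
  previous one times the unit \<open>- q t^(s-1)\<close>, so it is a greatest common divisor as well,
  but the operator \<open>\<Delta>\<close> changes by the inverse of that unit. Since the unit is congruent
  to \<open>-1\<close> modulo the divisor, the choice of normalisation affects the sign of the
  structure constants modulo inner derivations.
\<close>

definition gelt_uniform :: "complex \<Rightarrow> int \<Rightarrow> laurent" where
  "gelt_uniform q s = 1 - cscale q (tpow (s - 1))"

text \<open>
  The quotient \<open>\<Delta> = (id - \<sigma>) / g\<close>; it is determined by the description below when \<open>g\<close> is
  nonzero and divides every value of \<open>id - \<sigma>\<close>, because Laurent polynomials form an
  integral domain.
\<close>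

definition Delta :: "(laurent \<Rightarrow> laurent) \<Rightarrow> laurent \<Rightarrow> laurent \<Rightarrow> laurent" where
  "Delta \<sigma> g r = (THE x. g * x = r - \<sigma> r)"

definition dgen :: "(laurent \<Rightarrow> laurent) \<Rightarrow> laurent \<Rightarrow> int \<Rightarrow> laurent \<Rightarrow> laurent" where
  "dgen \<sigma> g n = lact (- tpow n) (Delta \<sigma> g)"

text \<open>
  \<open>\<D>\<^sub>\<sigma>\<close> is free of rank one on \<open>\<Delta>\<close>, so a \<open>\<sigma>\<close>-derivation has a unique coefficient.
\<close>

definition Delta_coeff ::
    "(laurent \<Rightarrow> laurent) \<Rightarrow> laurent \<Rightarrow> (laurent \<Rightarrow> laurent) \<Rightarrow> laurent" where
  "Delta_coeff \<sigma> g X = (THE a. X = lact a (Delta \<sigma> g))"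

definition sbracket ::
    "(laurent \<Rightarrow> laurent) \<Rightarrow> laurent \<Rightarrow> (laurent \<Rightarrow> laurent) \<Rightarrow> (laurent \<Rightarrow> laurent) \<Rightarrow>
     laurent \<Rightarrow> laurent" where
  "sbracket \<sigma> g X Y =
     (let a = Delta_coeff \<sigma> g X; b = Delta_coeff \<sigma> g Y; \<Delta> = Delta \<sigma> g
      in (\<lambda>r. (lact (\<sigma> a) \<Delta> \<circ> lact b \<Delta>) r - (lact (\<sigma> b) \<Delta> \<circ> lact a \<Delta>) r))"

end

theory Submission
  imports Defs
begin

text \<open>
  Put \<open>h = q t^(s-1)\<close>, so that \<open>\<sigma>(t^k) = h^k t^k\<close>. All the divisors in question are
  related to \<open>h\<close> by \<open>g w = 1 - h\<close>, with \<open>w = 1\<close> for \<open>g = 1 - q t^(s-1)\<close> and \<open>w = - h\<close> for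
  \<open>g = 1 - q^(-1) t^(1-s) = 1 - h^(-1)\<close>. From \<open>g \<Delta>(t^k) = (1 - h^k) t^k\<close> one computes,
  for \<open>0 \<le> n < m\<close>,
  \<open>g (\<sigma>(t^n) \<Delta>(t^m) - \<sigma>(t^m) \<Delta>(t^n)) = (h^n - h^m) t^(m+n)\<close>,
  and dividing by \<open>g\<close> gives the closed form
  \<open>[d_n, d_m] = w h^n (1 + h + \<dots> + h^(m-n-1)) t^(m+n) \<Delta>\<close> (lemma \<open>sbracket_dgen\<close>).
  For \<open>n = 0\<close>, \<open>m = 1\<close> the power and the geometric sum are both \<open>1\<close>, hence the exact
  value \<open>w t \<Delta>\<close>.

  The inner derivations contain \<open>a g \<Delta>\<close> for every \<open>a\<close>, because \<open>g \<Delta> = id - \<sigma>\<close>. So two multiples of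
  \<open>\<Delta>\<close> are equivalent as soon as their coefficients agree modulo \<open>g\<close>, and everything else
  is arithmetic modulo \<open>g\<close>. There \<open>h\<close> is \<open>1\<close>; thus \<open>h^n\<close> becomes \<open>1\<close>, the geometric sum
  becomes \<open>m - n\<close>, and \<open>w\<close> becomes \<open>1\<close> or \<open>-1\<close>, which is where the sign depends on the
  choice of \<open>g\<close>. The same congruence \<open>q t^(s-1) = 1\<close> moves exponents by \<open>d = |s - 1|\<close>:
  \<open>t^k\<close> is \<open>q^(-1) t^(k-d)\<close> if \<open>s \<ge> 1\<close> and \<open>q t^(k-d)\<close> if \<open>s < 1\<close>.
  This brings the index \<open>m + n\<close> back into the range from \<open>0\<close> to \<open>d - 1\<close> when \<open>n + m \<ge> d\<close>.
\<close>

section \<open>Constants and monomials\<close>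

lemma const_mult: "const c * const c' = const (c * c')"
  by (simp add: const_def mult_single)

lemma const_one: "const 1 = 1"
  by (simp add: const_def)

lemma const_uminus: "const (- c) = - const c"
  by (simp add: const_def single_uminus)

lemma const_of_int: "const (of_int k) = of_int k"
  by (simp add: const_def)

lemma tpow_mult: "tpow a * tpow b = tpow (a + b)"
  by (simp add: tpow_def mult_single)

lemma tpow_zero: "tpow 0 = 1"
  by (simp add: tpow_def)

lemma tpow_nonzero: "tpow k \<noteq> 0"
  by (metis tpow_mult tpow_zero add.right_inverse mult_zero_left zero_neq_one)

lemma tpow_of_nat: "tpow (of_nat k) = tpow 1 ^ k"
  by (induction k) (simp_all add: tpow_zero flip: tpow_mult)

lemma laurent_eq_sum_monomials:
  "(a :: laurent) = (\<Sum>k\<in>Poly_Mapping.keys a. const (Poly_Mapping.lookup a k) * tpow k)"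
  by (rule poly_mapping_eqI)
    (simp add: const_def tpow_def mult_single lookup_sum lookup_single when_def
      in_keys_iff)

section \<open>Congruences in commutative rings\<close>

text \<open>
  Every term of the sum is congruent to \<open>1\<close>. This is what turns the \<open>h\<close>-analogue
  \<open>(1 - h^k) / (1 - h)\<close> of \<open>k\<close> into \<open>k\<close> itself.
\<close>

lemma geometric_sum_cong_of_nat:
  fixes g h :: "'a :: comm_ring_1"
  assumes "g dvd h - 1"
  shows "g dvd (\<Sum>i<k. h ^ i) - of_nat k"
proof -
  have "g dvd h ^ i - 1" for i
    using assms by (metis dvd_mult2 power_diff_1_eq)
  then have "g dvd (\<Sum>i<k. h ^ i - 1)"
    by (simp add: dvd_sum)
  then show ?thesis
    by (simp add: sum_subtractf)
qed

lemma dvd_diff_mult_cong: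
  fixes g :: "'a :: comm_ring_1"
  assumes "g dvd a - a'" and "g dvd b - b'"
  shows "g dvd a * b - a' * b'"
proof -
  have "a * b - a' * b' = (a - a') * b + a' * (b - b')"
    by (simp add: algebra_simps)
  then show ?thesis
    using assms by simp
qed

section \<open>Endomorphisms sending \<open>t\<close> to a monomial\<close>

locale monomial_endomorphism =
  fixes \<sigma> :: "laurent \<Rightarrow> laurent" and q :: complex and s :: int
  assumes endo: "algebra_endomorphism \<sigma>"
    and nontrivial: "\<sigma> \<noteq> id"
    and q_nonzero: "q \<noteq> 0"
    and sigma_t: "\<sigma> (tpow 1) = cscale q (tpow s)"
begin

text \<open>The unit by which \<open>\<sigma>\<close> multiplies \<open>t\<close>; all computations are done in powers of it.\<close>

definition h :: laurent where
  "h = cscale q (tpow (s - 1))"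

lemma sigma_add: "\<sigma> (a + b) = \<sigma> a + \<sigma> b"
  and sigma_cscale: "\<sigma> (cscale c a) = cscale c (\<sigma> a)"
  using endo by (auto simp: algebra_endomorphism_def Vector_Spaces.linear_iff)

lemma sigma_one: "\<sigma> 1 = 1"
  and sigma_mult: "\<sigma> (a * b) = \<sigma> a * \<sigma> b"
  using endo by (auto simp: algebra_endomorphism_def)

lemma sigma_zero: "\<sigma> 0 = 0"
  using sigma_add [of 0 0] by simp

lemma sigma_uminus: "\<sigma> (- a) = - \<sigma> a"
  using sigma_add [of a "- a"] by (simp add: sigma_zero eq_neg_iff_add_eq_0 add.commute)

lemma sigma_sum: "\<sigma> (sum f A) = (\<Sum>x\<in>A. \<sigma> (f x))"
  by (induction A rule: infinite_finite_induct) (simp_all add: sigma_zero sigma_add)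

lemma sigma_power: "\<sigma> (a ^ k) = \<sigma> a ^ k"
  by (induction k) (simp_all add: sigma_one sigma_mult)

lemma sigma_const_mult: "\<sigma> (const c * a) = const c * \<sigma> a"
  using sigma_cscale by (simp add: cscale_def)

lemma sigma_t_eq: "\<sigma> (tpow 1) = h * tpow 1"
  by (simp add: sigma_t h_def cscale_def mult.assoc tpow_mult)

lemma sigma_tpow_of_nat: "\<sigma> (tpow (of_nat k)) = h ^ k * tpow (of_nat k)"
  by (simp add: tpow_of_nat sigma_power sigma_t_eq power_mult_distrib)

text \<open>
  For nonnegative powers of \<open>t\<close> this is the factorization of \<open>1 - h^k\<close>. It passes to
  inverses, since \<open>a - \<sigma> a\<close> is \<open>- a \<sigma>(a)\<close> times \<open>b - \<sigma> b\<close> if \<open>a b = 1\<close>, and so to all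
  powers of \<open>t\<close>, and then to linear combinations of them.
\<close>

lemma dvd_diff_sigma: "1 - h dvd r - \<sigma> r"
proof -
  have unit: "1 - h dvd a - \<sigma> a" if "a * b = 1" and "1 - h dvd b - \<sigma> b" for a b
  proof -
    have "\<sigma> a * \<sigma> b = 1"
      using that(1) by (metis sigma_mult sigma_one)
    then have "a - \<sigma> a = - (a * \<sigma> a) * (b - \<sigma> b)"
      using that(1) by algebra
    then show ?thesis
      using that(2) by simp
  qed
  have nat: "1 - h dvd tpow (of_nat k) - \<sigma> (tpow (of_nat k))" for k
  proof -
    have "tpow (of_nat k) - \<sigma> (tpow (of_nat k)) = (1 - h ^ k) * tpow (of_nat k)"
      by (simp add: sigma_tpow_of_nat algebra_simps)
    then show ?thesis
      by (simp add: one_diff_power_eq mult.assoc)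
  qed
  have mono: "1 - h dvd tpow k - \<sigma> (tpow k)" for k
  proof (cases "k \<ge> 0")
    case True
    then show ?thesis
      using nat [of "nat k"] by simp
  next
    case False
    then show ?thesis
      using nat [of "nat (- k)"] by - (rule unit [of _ "tpow (- k)"],
        simp_all add: tpow_mult tpow_zero)
  qed
  define R where "R = (\<Sum>k\<in>Poly_Mapping.keys r. const (Poly_Mapping.lookup r k) * tpow k)"
  have "R - \<sigma> R = (\<Sum>k\<in>Poly_Mapping.keys r. const (Poly_Mapping.lookup r k) * (tpow k - \<sigma> (tpow k)))"
    by (simp add: R_def sigma_sum sigma_const_mult sum_subtractf right_diff_distrib)
  then have "1 - h dvd R - \<sigma> R"
    using mono by (simp add: dvd_sum)
  then show ?thesis
    by (simp add: R_def flip: laurent_eq_sum_monomials)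
qed

text \<open>If \<open>h\<close> were \<open>1\<close>, the preceding divisibility would make \<open>id - \<sigma>\<close> vanish.\<close>

lemma h_neq_one: "h \<noteq> 1"
proof
  assume "h = 1"
  then have "\<sigma> r = r" for r
    using dvd_diff_sigma [of r] by simp
  then show False
    using nontrivial by auto
qed

end

section \<open>The bracket for a divisor of \<open>1 - h\<close>\<close>

text \<open>
  The cofactor \<open>w\<close> is kept as a parameter because it equals \<open>\<Delta>(t) / t\<close> and appears as a
  factor of every bracket; this treats the associated choices of the divisor at once.
\<close>

locale sigma_divisor = monomial_endomorphism +
  fixes g w :: laurent
  assumes factorization: "g * w = 1 - h"
begin

abbreviation \<Delta> :: "laurent \<Rightarrow> laurent" where
  "\<Delta> \<equiv> Delta \<sigma> g"

lemma g_nonzero: "g \<noteq> 0"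
  using factorization h_neq_one by auto

lemma w_nonzero: "w \<noteq> 0"
  using factorization h_neq_one by auto

lemma h_cong_one: "g dvd h - 1"
  by (rule dvdI [of _ _ "- w"]) (simp add: factorization)

text \<open>
  The definite description in the definition of \<open>\<Delta>\<close> is meaningful: existence is the
  divisibility by \<open>1 - h\<close>, uniqueness holds since Laurent polynomials form an integral
  domain. The identities for \<open>\<Delta>\<close> are then checked after multiplication by \<open>g\<close>.
\<close>

lemma g_mult_Delta: "g * \<Delta> r = r - \<sigma> r"
proof -
  have "g dvd r - \<sigma> r"
    by (rule dvd_mult_left [of g w]) (simp add: factorization dvd_diff_sigma)
  then obtain x where "g * x = r - \<sigma> r"
    by (metis dvdE)
  then have "\<exists>!x. g * x = r - \<sigma> r"
    using g_nonzero by (metis mult_left_cancel)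
  then show ?thesis
    unfolding Delta_def by (rule theI')
qed

lemma Delta_eqI: "g * x = r - \<sigma> r \<Longrightarrow> \<Delta> r = x"
  using g_mult_Delta g_nonzero by (metis mult_left_cancel)

lemma Delta_add: "\<Delta> (a + b) = \<Delta> a + \<Delta> b"
  by (rule Delta_eqI) (simp add: distrib_left g_mult_Delta sigma_add)

lemma Delta_cscale: "\<Delta> (cscale c a) = cscale c (\<Delta> a)"
proof (rule Delta_eqI)
  have "g * cscale c (\<Delta> a) = const c * (g * \<Delta> a)"
    by (simp add: cscale_def mult.left_commute)
  then show "g * cscale c (\<Delta> a) = cscale c a - \<sigma> (cscale c a)"
    by (simp add: g_mult_Delta sigma_cscale) (simp add: cscale_def right_diff_distrib)
qed

lemma Delta_mult: "\<Delta> (a * b) = \<sigma> a * \<Delta> b + \<Delta> a * b"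
proof (rule Delta_eqI)
  have "g * (\<sigma> a * \<Delta> b + \<Delta> a * b) = \<sigma> a * (g * \<Delta> b) + (g * \<Delta> a) * b"
    by (simp add: algebra_simps)
  then show "g * (\<sigma> a * \<Delta> b + \<Delta> a * b) = a * b - \<sigma> (a * b)"
    by (simp add: g_mult_Delta sigma_mult algebra_simps)
qed

lemma Delta_t: "\<Delta> (tpow 1) = w * tpow 1"
proof (rule Delta_eqI)
  have "g * (w * tpow 1) = (1 - h) * tpow 1"
    by (simp add: factorization flip: mult.assoc)
  then show "g * (w * tpow 1) = tpow 1 - \<sigma> (tpow 1)"
    by (simp add: sigma_t_eq left_diff_distrib)
qed

text \<open>
  Evaluation at \<open>t\<close> recovers the coefficient, because \<open>\<Delta>(t) = w t\<close> is nonzero. Hence the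
  bracket, which is defined through coefficients, can be computed.
\<close>

lemma lact_Delta_inject: "lact a \<Delta> = lact b \<Delta> \<longleftrightarrow> a = b"
proof
  assume "lact a \<Delta> = lact b \<Delta>"
  then have "a * (w * tpow 1) = b * (w * tpow 1)"
    by (metis lact_def Delta_t)
  then show "a = b"
    using w_nonzero tpow_nonzero by simp
qed simp

lemma Delta_coeff_lact: "Delta_coeff \<sigma> g (lact a \<Delta>) = a"
  unfolding Delta_coeff_def lact_Delta_inject by simp

lemma lact_Delta_derivation: "lact a \<Delta> \<in> sigma_derivations \<sigma>"
proof -
  have "Vector_Spaces.linear cscale cscale (lact a \<Delta>)"
    unfolding Vector_Spaces.linear_iff
    by (simp add: vector_space_cscale lact_def Delta_add Delta_cscale distrib_left)
      (simp add: cscale_def mult.left_commute)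
  then show ?thesis
    by (simp add: sigma_derivations_def lact_def Delta_mult algebra_simps)
qed

lemma lact_Delta_inner: "g dvd a \<Longrightarrow> lact a \<Delta> \<in> inner_derivations \<sigma>"
proof (elim dvdE)
  fix p assume "a = g * p"
  then have "lact a \<Delta> r = p * (r - \<sigma> r)" for r
    by (simp add: lact_def mult_ac flip: g_mult_Delta)
  then show ?thesis
    using lact_Delta_derivation by (auto simp: inner_derivations_def)
qed

text \<open>This reduces the equivalence of derivations to congruence of coefficients modulo \<open>g\<close>.\<close>

lemma lact_Delta_equiv:
  assumes "g dvd a - b"
  shows "inner_equiv \<sigma> (lact a \<Delta>) (lact b \<Delta>)"
proof -
  have "(\<lambda>r. lact a \<Delta> r - lact b \<Delta> r) = lact (a - b) \<Delta>"
    by (simp add: lact_def left_diff_distrib)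
  then show ?thesis
    using assms by (simp add: inner_equiv_def lact_Delta_derivation lact_Delta_inner)
qed

text \<open>
  Expanding both compositions by the twisted product rule, the second-order terms
  \<open>\<sigma>(a) \<sigma>(b) \<Delta>(\<Delta>(r))\<close> cancel.
\<close>

lemma sbracket_lact:
  "sbracket \<sigma> g (lact a \<Delta>) (lact b \<Delta>) = lact (\<sigma> a * \<Delta> b - \<sigma> b * \<Delta> a) \<Delta>"
  unfolding sbracket_def Let_def Delta_coeff_lact
  by (rule ext) (simp add: lact_def Delta_mult algebra_simps)

lemma Delta_uminus: "\<Delta> (- a) = - \<Delta> a"
  by (rule Delta_eqI) (simp add: g_mult_Delta sigma_uminus)

lemma lact_dgen: "lact a (dgen \<sigma> g n) = lact (- a * tpow n) \<Delta>"
  by (simp add: lact_def dgen_def fun_eq_iff)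

text \<open>
  The numerator \<open>h^n - h^m\<close> is \<open>h^n (1 - h^(m-n))\<close>, whose second factor is \<open>1 - h = g w\<close>
  times a geometric sum.
\<close>

lemma sbracket_dgen:
  assumes "0 \<le> n" and "n < m"
  shows "sbracket \<sigma> g (dgen \<sigma> g n) (dgen \<sigma> g m) =
    lact (w * (h ^ nat n * (\<Sum>i<nat (m - n). h ^ i)) * tpow (m + n)) \<Delta>"
proof -
  define k where "k = nat n"
  define l where "l = nat (m - n)"
  have n: "n = int k" and m: "m = int (k + l)"
    using assms by (simp_all add: k_def l_def)
  let ?c = "\<sigma> (tpow n) * \<Delta> (tpow m) - \<sigma> (tpow m) * \<Delta> (tpow n)"
  have "g * ?c = \<sigma> (tpow n) * (g * \<Delta> (tpow m)) - \<sigma> (tpow m) * (g * \<Delta> (tpow n))"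
    by (simp add: algebra_simps)
  also have "\<dots> = \<sigma> (tpow n) * tpow m - \<sigma> (tpow m) * tpow n"
    by (simp add: g_mult_Delta algebra_simps)
  also have "\<dots> = h ^ k * (1 - h ^ l) * (tpow m * tpow n)"
    unfolding n m sigma_tpow_of_nat by (simp add: power_add algebra_simps)
  also have "\<dots> = g * (w * (h ^ k * (\<Sum>i<l. h ^ i)) * tpow (m + n))"
    unfolding one_diff_power_eq tpow_mult factorization [symmetric] by (simp add: mult_ac)
  finally have "?c = w * (h ^ k * (\<Sum>i<l. h ^ i)) * tpow (m + n)"
    using g_nonzero by simp
  then show ?thesis
    by (simp add: dgen_def sbracket_lact Delta_uminus sigma_uminus k_def l_def)
qed

text \<open>
  The closed form reduced modulo \<open>g\<close>. The target exponent \<open>e\<close> and the factor \<open>z\<close> are free, so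
  that the same statement serves \<open>e = m + n\<close> and the exponents shifted by \<open>\<bar>s - 1\<bar>\<close>. The
  order of \<open>n\<close> and \<open>m\<close> in \<open>x\<close> absorbs the sign in \<open>d_e = - t^e \<Delta>\<close>.
\<close>

lemma sbracket_dgen_equiv:
  assumes "0 \<le> n" and "n < m"
    and w: "g dvd w - const c"
    and shift: "g dvd tpow (m + n) - const z * tpow e"
    and x: "x = c * of_int (n - m) * z"
  shows "inner_equiv \<sigma> (sbracket \<sigma> g (dgen \<sigma> g n) (dgen \<sigma> g m)) (lact (const x) (dgen \<sigma> g e))"
proof -
  have "g dvd h ^ nat n - 1"
    using h_cong_one by (metis dvd_mult2 power_diff_1_eq)
  moreover have "g dvd (\<Sum>i<nat (m - n). h ^ i) - of_int (m - n)"
    using geometric_sum_cong_of_nat [OF h_cong_one, of "nat (m - n)"] assms(2) by simp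
  ultimately have "g dvd w * (h ^ nat n * (\<Sum>i<nat (m - n). h ^ i)) * tpow (m + n) -
      const c * (1 * of_int (m - n)) * (const z * tpow e)"
    by (intro dvd_diff_mult_cong w shift)
  moreover have "const x = - (const c * of_int (m - n) * const z)"
    unfolding x const_mult [symmetric] const_of_int by (simp add: algebra_simps)
  ultimately show ?thesis
    unfolding sbracket_dgen [OF assms(1,2)] lact_dgen
    by (intro lact_Delta_equiv) (simp add: mult.assoc)
qed

text \<open>
  For \<open>s \<ge> 1\<close>, \<open>h = q t^\<bar>s - 1\<bar>\<close> is congruent to \<open>1\<close>, so lowering the exponent by
  \<open>\<bar>s - 1\<bar>\<close> costs \<open>q^(-1)\<close>; for \<open>s < 1\<close>, \<open>h = q t^(- \<bar>s - 1\<bar>)\<close> and it costs \<open>q\<close>.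
\<close>

lemma tpow_cong_shift_ge:
  assumes "s \<ge> 1"
  shows "g dvd tpow k - const (inverse q) * tpow (k - \<bar>s - 1\<bar>)"
proof -
  have "tpow k = const (inverse q) * h * tpow (k - \<bar>s - 1\<bar>)"
    using assms q_nonzero
    by (simp add: h_def cscale_def mult.assoc tpow_mult)
      (simp add: const_mult const_one flip: mult.assoc)
  then have "tpow k - const (inverse q) * tpow (k - \<bar>s - 1\<bar>) =
      (h - 1) * (const (inverse q) * tpow (k - \<bar>s - 1\<bar>))"
    by (simp add: algebra_simps)
  then show ?thesis
    using h_cong_one by simp
qed

lemma tpow_cong_shift_less:
  assumes "s < 1"
  shows "g dvd tpow k - const q * tpow (k - \<bar>s - 1\<bar>)"
proof -
  have "const q * tpow (k - \<bar>s - 1\<bar>) = h * tpow k"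
    using assms by (simp add: h_def cscale_def mult.assoc tpow_mult algebra_simps)
  then have "tpow k - const q * tpow (k - \<bar>s - 1\<bar>) = (h - 1) * - tpow k"
    by (simp add: algebra_simps)
  then show ?thesis
    using h_cong_one by (metis dvd_mult2)
qed

lemma sbracket_dgen_equiv_same:
  assumes "0 \<le> n" and "n < m" and "g dvd w - const c"
  shows "inner_equiv \<sigma> (sbracket \<sigma> g (dgen \<sigma> g n) (dgen \<sigma> g m))
    (lact (const (c * of_int (n - m))) (dgen \<sigma> g (m + n)))"
  using assms by (intro sbracket_dgen_equiv [where z = 1]) (simp_all add: const_one)

lemma sbracket_d0_decomposition:
  assumes "0 < m" and "g dvd w - const c"
  shows "\<exists>E\<in>inner_derivations \<sigma>. sbracket \<sigma> g (dgen \<sigma> g 0) (dgen \<sigma> g m) =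
    (\<lambda>r. lact (const (- (c * of_int m))) (dgen \<sigma> g m) r + E r)"
  using sbracket_dgen_equiv_same [of 0 m c] assms
  by (intro bexI [of _ "\<lambda>r. sbracket \<sigma> g (dgen \<sigma> g 0) (dgen \<sigma> g m) r -
        lact (const (- (c * of_int m))) (dgen \<sigma> g m) r"])
    (simp_all add: inner_equiv_def)

lemma sbracket_d0_d1: "sbracket \<sigma> g (dgen \<sigma> g 0) (dgen \<sigma> g 1) = lact (w * tpow 1) \<Delta>"
  by (simp add: sbracket_dgen)

end

section \<open>The structure constants\<close>

(* First block: s >= 1.
   Second block: s < 1 and the divisor 1 - q^(-1) t^(1-s); the structure constants carry the
   opposite sign and the exact value of [d_0, d_1] is q d_s.
   Third block: s < 1 and the associated divisor 1 - q t^(s-1), with the same structure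
   constants as for s >= 1 (up to the power of q). *)
theorem proposition4p4p2:
  fixes \<sigma> :: "laurent \<Rightarrow> laurent" and q :: complex and s :: int
  assumes "algebra_endomorphism \<sigma>" and "\<sigma> \<noteq> id"
    and "q \<noteq> 0" and "\<sigma> (tpow 1) = cscale q (tpow s)"
  shows "\<forall>n m. 0 \<le> n \<and> n < m \<and> m < \<bar>s - 1\<bar> \<longrightarrow>
    (s \<ge> 1 \<longrightarrow>
      (let d = dgen \<sigma> (gelt q s); br = sbracket \<sigma> (gelt q s) in
        (n + m < \<bar>s - 1\<bar> \<longrightarrow>
          inner_equiv \<sigma> (br (d n) (d m)) (lact (const (of_int (n - m))) (d (m + n)))) \<and>
        (n = 0 \<longrightarrow> (\<exists>E \<in> inner_derivations \<sigma>.
          br (d 0) (d m) = (\<lambda>r. lact (const (- of_int m)) (d m) r + E r))) \<and>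
        (n = 0 \<and> m = 1 \<longrightarrow> br (d 0) (d 1) = (\<lambda>r. - d 1 r)) \<and>
        (n + m \<ge> \<bar>s - 1\<bar> \<longrightarrow>
          inner_equiv \<sigma> (br (d n) (d m))
            (lact (const (of_int (n - m) / q)) (d (m + n - \<bar>s - 1\<bar>)))))) \<and>
    (s < 1 \<longrightarrow>
      (let d = dgen \<sigma> (gelt q s); br = sbracket \<sigma> (gelt q s) in
        (n + m < \<bar>s - 1\<bar> \<longrightarrow>
          inner_equiv \<sigma> (br (d n) (d m)) (lact (const (- of_int (n - m))) (d (m + n)))) \<and>
        (n = 0 \<longrightarrow> (\<exists>E \<in> inner_derivations \<sigma>.
          br (d 0) (d m) = (\<lambda>r. lact (const (of_int m)) (d m) r + E r))) \<and>
        (n = 0 \<and> m = 1 \<longrightarrow> br (d 0) (d 1) = lact (const q) (d s)) \<and>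
        (n + m \<ge> \<bar>s - 1\<bar> \<longrightarrow>
          inner_equiv \<sigma> (br (d n) (d m))
            (lact (const (- (q * of_int (n - m)))) (d (m + n - \<bar>s - 1\<bar>)))))) \<and>
    (s < 1 \<longrightarrow>
      (let d = dgen \<sigma> (gelt_uniform q s); br = sbracket \<sigma> (gelt_uniform q s) in
        (n + m < \<bar>s - 1\<bar> \<longrightarrow>
          inner_equiv \<sigma> (br (d n) (d m)) (lact (const (of_int (n - m))) (d (m + n)))) \<and>
        (n = 0 \<longrightarrow> (\<exists>E \<in> inner_derivations \<sigma>.
          br (d 0) (d m) = (\<lambda>r. lact (const (- of_int m)) (d m) r + E r))) \<and>
        (n = 0 \<and> m = 1 \<longrightarrow> br (d 0) (d 1) = (\<lambda>r. - d 1 r)) \<and>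
        (n + m \<ge> \<bar>s - 1\<bar> \<longrightarrow>
          inner_equiv \<sigma> (br (d n) (d m))
            (lact (const (q * of_int (n - m))) (d (m + n - \<bar>s - 1\<bar>))))))"
proof -
  interpret monomial_endomorphism \<sigma> q s
    using assms by unfold_locales
  have gu: "gelt_uniform q s = 1 - h"
    by (simp add: gelt_uniform_def h_def)
  \<comment> \<open>Here \<open>g = 1 - h^(-1)\<close>, and multiplying by \<open>- h\<close> gives \<open>1 - h\<close>.\<close>
  have gneg: "gelt q s * - h = 1 - h" if "s < 1"
  proof -
    have "cscale (inverse q) (tpow (1 - s)) * h =
        (const (inverse q) * const q) * (tpow (1 - s) * tpow (s - 1))"
      by (simp add: h_def cscale_def mult_ac)
    also have "\<dots> = 1"
      using assms(3) by (simp add: const_mult tpow_mult const_one tpow_zero)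
    finally show ?thesis
      using that by (simp add: gelt_def algebra_simps)
  qed
  have uniform: "sigma_divisor \<sigma> q s (gelt_uniform q s) 1"
    by unfold_locales (simp add: gu)
  have one: "gelt_uniform q s dvd 1 - const 1"
    by (simp add: const_one)
  have pos: "gelt q s = gelt_uniform q s" if "s \<ge> 1"
    using that by (simp add: gelt_def gelt_uniform_def)
  have neg: "sigma_divisor \<sigma> q s (gelt q s) (- h)" if "s < 1"
    by unfold_locales (rule gneg [OF that])
  have minus_one: "gelt q s dvd - h - const (- 1)" if "s < 1"
  proof -
    have "gelt q s dvd - (h - 1)"
      using sigma_divisor.h_cong_one [OF neg [OF that]] by (simp only: dvd_minus_iff)
    then show ?thesis
      by (simp add: const_uminus const_one)
  qed
  have d0_d1_uniform: "sbracket \<sigma> (gelt_uniform q s) (dgen \<sigma> (gelt_uniform q s) 0)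
      (dgen \<sigma> (gelt_uniform q s) 1) = (\<lambda>r. - dgen \<sigma> (gelt_uniform q s) 1 r)"
    unfolding sigma_divisor.sbracket_d0_d1 [OF uniform] by (simp add: dgen_def lact_def)
  \<comment> \<open>The exact value is \<open>w t \<Delta> = - h t \<Delta>\<close>, and \<open>h t = q t^s\<close>.\<close>
  have d0_d1_neg: "sbracket \<sigma> (gelt q s) (dgen \<sigma> (gelt q s) 0)
      (dgen \<sigma> (gelt q s) 1) = lact (const q) (dgen \<sigma> (gelt q s) s)" if "s < 1"
    unfolding sigma_divisor.sbracket_d0_d1 [OF neg [OF that]]
      sigma_divisor.lact_dgen [OF neg [OF that]]
    by (simp add: h_def cscale_def mult.assoc tpow_mult)
  have ge: "inner_equiv \<sigma>
      (sbracket \<sigma> (gelt_uniform q s) (dgen \<sigma> (gelt_uniform q s) n) (dgen \<sigma> (gelt_uniform q s) m))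
      (lact (const (of_int (n - m) / q)) (dgen \<sigma> (gelt_uniform q s) (m + n - \<bar>s - 1\<bar>)))"
    if "s \<ge> 1" "0 \<le> n" "n < m" for n m
    by (rule sigma_divisor.sbracket_dgen_equiv [OF uniform that(2,3) one
          sigma_divisor.tpow_cong_shift_ge [OF uniform that(1)]])
      (simp add: field_simps)
  have less: "inner_equiv \<sigma>
      (sbracket \<sigma> (gelt_uniform q s) (dgen \<sigma> (gelt_uniform q s) n) (dgen \<sigma> (gelt_uniform q s) m))
      (lact (const (q * of_int (n - m))) (dgen \<sigma> (gelt_uniform q s) (m + n - \<bar>s - 1\<bar>)))"
    if "s < 1" "0 \<le> n" "n < m" for n m
    by (rule sigma_divisor.sbracket_dgen_equiv [OF uniform that(2,3) one
          sigma_divisor.tpow_cong_shift_less [OF uniform that(1)]]) simp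
  have less_neg: "inner_equiv \<sigma>
      (sbracket \<sigma> (gelt q s) (dgen \<sigma> (gelt q s) n) (dgen \<sigma> (gelt q s) m))
      (lact (const (- (q * of_int (n - m)))) (dgen \<sigma> (gelt q s) (m + n - \<bar>s - 1\<bar>)))"
    if "s < 1" "0 \<le> n" "n < m" for n m
    by (rule sigma_divisor.sbracket_dgen_equiv [OF neg [OF that(1)] that(2,3)
          minus_one [OF that(1)] sigma_divisor.tpow_cong_shift_less [OF neg [OF that(1)] that(1)]])
      (simp add: algebra_simps)
  note uniform_facts = sigma_divisor.sbracket_dgen_equiv_same [OF uniform _ _ one]
    sigma_divisor.sbracket_d0_decomposition [OF uniform _ one]
  note neg_facts = sigma_divisor.sbracket_dgen_equiv_same [OF neg _ _ minus_one]
    sigma_divisor.sbracket_d0_decomposition [OF neg _ minus_one]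
  show ?thesis
    unfolding Let_def
    using uniform_facts neg_facts pos ge less less_neg d0_d1_uniform d0_d1_neg
    by simp
qed

end
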